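(* Let $k\ge 2$ be an integer. Then, provided the limit defining $\operatorname{dens}(V(1,k))$ exists, $$\operatorname{dens}(V(1,k))\ge \prod_{p\text{ prime}}\Big(1-\frac{2}{p^2}\Big)\prod_{\substack{p\mid k\\ p\text{ prime}}}\Big(1+\frac{1}{p^2-2}\Big).$$
   Context: $\mathbb{N}$ denotes the positive integers and $\mathbb{Q}^+$ the positive rationals. A point $(a,b)\in\mathbb{N}^2$ is $\mathcal{F}(1,k)$-visible if there exists $q\in\mathbb{Q}^+$ such that $b=q(a^2+ka)$ and there is no other point of $\mathbb{N}^2$ on the curve $y=q(x^2+kx)$ between the origin and $(a,b)$ (i.e. no point $(a',b')\in\mathbb{N}^2$ on this curve with $a'<a$). $V(1,k)$ denotes the set of all $\mathcal{F}(1,k)$-visible points in $\mathbb{N}^2$. The density of a set $S\subseteq\mathbb{N}^2$ is $\operatorname{dens}(S)=\lim_{N\to\infty}\frac{|S\cap R_N|}{N^2}$, provided the limit exists, where $R_N=\{(a,b)\in\mathbb{Z}^2 : 1\le a,b\le N\}$ for $N\in\mathbb{N}$. *)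

theory Defs
  imports "HOL-Analysis.Analysis" "HOL-Computational_Algebra.Primes"
begin

definition posN2 :: "(nat \<times> nat) set" where
  "posN2 = {0<..} \<times> {0<..}"

definition curve :: "nat \<Rightarrow> rat \<Rightarrow> (nat \<times> nat) set" where
  "curve k q = {(a, b) \<in> posN2. rat_of_nat b = q * ((rat_of_nat a)\<^sup>2 + rat_of_nat k * rat_of_nat a)}"

definition visible :: "nat \<Rightarrow> nat \<times> nat \<Rightarrow> bool" where
  "visible k P \<longleftrightarrow>
     (\<exists>q>0. P \<in> curve k q \<and> \<not> (\<exists>P' \<in> curve k q. fst P' < fst P))"

definition V :: "nat \<Rightarrow> (nat \<times> nat) set" where
  "V k = {P \<in> posN2. visible k P}"

definition grid_square :: "nat \<Rightarrow> (nat \<times> nat) set" where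
  "grid_square N = {1..N} \<times> {1..N}"

definition dens_ratio :: "(nat \<times> nat) set \<Rightarrow> nat \<Rightarrow> real" where
  "dens_ratio S N = real (card (S \<inter> grid_square N)) / (real N)\<^sup>2"

text \<open>As \<^const>\<open>lim\<close> is total, \<open>dens S\<close> is meaningful only if \<open>dens_exists S\<close> holds.\<close>

definition dens_exists :: "(nat \<times> nat) set \<Rightarrow> bool" where
  "dens_exists S \<longleftrightarrow> convergent (dens_ratio S)"

definition dens :: "(nat \<times> nat) set \<Rightarrow> real" where
  "dens S = lim (dens_ratio S)"

text \<open>An infinite product over the primes is taken over all naturals, with factor 1 at the
  non-primes. The following lemma shows that the product of \<open>1 - 2 / p\<^sup>2\<close> converges, so that its
  \<^const>\<open>prodinf\<close> is the actual limit of the partial products.\<close>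

definition prod_over_primes :: "(nat \<Rightarrow> real) \<Rightarrow> real" where
  "prod_over_primes f = (\<Prod>n. if prime n then f n else 1)"

lemma convergent_prod_one_minus_two_over_prime_squared:
  "convergent_prod (\<lambda>n::nat. if prime n then 1 - 2 / (real n)\<^sup>2 else (1::real))"
proof -
  have "summable (\<lambda>n::nat. 2 * (1 / (real n)\<^sup>2))"
    using inverse_power_summable[of 2, where 'a=real]
    by (intro summable_mult) (simp add: field_simps)
  then have "summable (\<lambda>n::nat. norm ((if prime n then 1 - 2 / (real n)\<^sup>2 else (1::real)) - 1))"
    by (rule summable_comparison_test[rotated]) (auto intro!: exI[of _ 0])
  then have "abs_convergent_prod (\<lambda>n::nat. if prime n then 1 - 2 / (real n)\<^sup>2 else (1::real))"
    by (simp add: abs_convergent_prod_conv_summable)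
  then show ?thesis
    by (rule abs_convergent_prod_imp_convergent_prod)
qed

end

theory Submission
  imports Defs "HOL-Number_Theory.Cong"
begin

text \<open>
  A point \<open>(a, b)\<close> with \<open>b\<close> coprime to \<open>a (a + k)\<close> is visible: a lattice point \<open>(a', b')\<close> on the
  same curve satisfies \<open>b' a (a + k) = b a' (a' + k)\<close>, so \<open>a (a + k)\<close> divides \<open>a' (a' + k)\<close>, which
  is impossible for \<open>0 < a' < a\<close> (\<open>coprime_imp_visible\<close>). The claimed bound is the density of
  these coprime points: modulo a prime \<open>p\<close>, the residue pairs with \<open>p\<close> dividing both \<open>b\<close> and
  \<open>a (a + k)\<close> are \<open>(0, 0)\<close> and \<open>(-k, 0)\<close>, which coincide exactly if \<open>p\<close> divides \<open>k\<close>, and the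
  local factor \<open>1 - 1 / p\<^sup>2\<close> of the latter primes equals \<open>(1 - 2 / p\<^sup>2) (1 + 1 / (p\<^sup>2 - 2))\<close>.

  To bound the density of the coprime points from below, cut the sieve at a level \<open>z\<close>. The points
  that survive the primes up to \<open>z\<close> form a periodic set, whose density is the finite product of
  the local factors by the Chinese remainder theorem (\<open>card_sieved_square_ge\<close>). Among the points
  of the square of side \<open>N\<close>, a prime \<open>p > z\<close> spoils at most \<open>(k + 2) N\<^sup>2 / p\<^sup>2\<close>, and none at all if
  \<open>p > N\<close> because then \<open>p\<close> does not divide \<open>b\<close>; so all large primes together spoil a proportion of
  at most \<open>(k + 2) / z\<close>, uniformly in \<open>N\<close> (\<open>card_large_prime_points_le\<close>). The theorem follows on
  letting first \<open>N\<close> and then \<open>z\<close> tend to infinity.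
\<close>

section \<open>Coprime points are visible\<close>

lemma coprime_imp_visible:
  assumes "a > 0" "b > 0" "coprime b (a * (a + k))"
  shows "(a, b) \<in> V k"
proof -
  define q where "q = rat_of_nat b / (rat_of_nat a ^ 2 + rat_of_nat k * rat_of_nat a)"
  have den: "rat_of_nat a ^ 2 + rat_of_nat k * rat_of_nat a > 0"
    using assms by (simp add: add_pos_nonneg)
  have "False" if "(a', b') \<in> curve k q" "a' < a" for a' b'
  proof -
    from that have pos: "a' > 0" "b' > 0"
      and eq: "rat_of_nat b' = q * (rat_of_nat a' ^ 2 + rat_of_nat k * rat_of_nat a')"
      by (auto simp: curve_def posN2_def)
    from eq den have "rat_of_nat b' * (rat_of_nat a ^ 2 + rat_of_nat k * rat_of_nat a) =
        rat_of_nat b * (rat_of_nat a' ^ 2 + rat_of_nat k * rat_of_nat a')"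
      by (simp add: q_def)
    then have "rat_of_nat (b' * (a * (a + k))) = rat_of_nat (b * (a' * (a' + k)))"
      by (simp add: algebra_simps power2_eq_square)
    then have "b' * (a * (a + k)) = b * (a' * (a' + k))"
      by (simp only: of_nat_eq_iff)
    then have "a * (a + k) dvd b * (a' * (a' + k))"
      by (metis dvd_triv_right)
    then have "a * (a + k) dvd a' * (a' + k)"
      using assms(3) by (simp add: coprime_dvd_mult_right_iff coprime_commute)
    then have "a * (a + k) \<le> a' * (a' + k)"
      using pos by (intro dvd_imp_le) auto
    moreover have "a' * (a' + k) < a * (a + k)"
      using that(2) by (intro mult_strict_mono) auto
    ultimately show False by simp
  qed
  moreover have "(a, b) \<in> curve k q"
    using assms den by (simp add: curve_def posN2_def q_def)
  moreover have "q > 0"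
    using assms den by (simp add: q_def)
  ultimately show ?thesis
    using assms unfolding V_def visible_def posN2_def by fastforce
qed

section \<open>Sieving by the small primes\<close>

text \<open>By periodicity it suffices to count residues, and by the Chinese remainder theorem these can
  be prescribed independently for the various moduli.\<close>

lemma card_residue_pairs_ge:
  fixes F :: "nat set" and T :: "nat \<Rightarrow> (nat \<times> nat) set"
  assumes F: "finite F" "\<And>p. p \<in> F \<Longrightarrow> prime p"
    and T: "\<And>p. p \<in> F \<Longrightarrow> T p \<subseteq> {..<p} \<times> {..<p}"
  shows "(\<Prod>p\<in>F. card (T p)) \<le>
    card {(a, b) \<in> {..<\<Prod>F} \<times> {..<\<Prod>F}. \<forall>p\<in>F. (a mod p, b mod p) \<in> T p}"
    (is "_ \<le> card ?A")
proof -
  define res where "res = (\<lambda>(a, b). \<lambda>p\<in>F. (a mod p, b mod p) :: nat \<times> nat)"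
  have crt: "\<exists>x < \<Prod>F. \<forall>p\<in>F. x mod p = u p mod p" for u
  proof -
    have "\<exists>!x. x < \<Prod>F \<and> (\<forall>p\<in>F. [x = u p] (mod p))"
      using F by (intro chinese_remainder_unique_nat) (auto simp: primes_coprime prime_gt_0_nat)
    then show ?thesis by (auto simp: cong_def)
  qed
  have "PiE F T \<subseteq> res ` ?A"
  proof
    fix u assume u: "u \<in> PiE F T"
    obtain a where a: "a < \<Prod>F" "\<forall>p\<in>F. a mod p = fst (u p) mod p"
      using crt[of "\<lambda>p. fst (u p)"] by blast
    obtain b where b: "b < \<Prod>F" "\<forall>p\<in>F. b mod p = snd (u p) mod p"
      using crt[of "\<lambda>p. snd (u p)"] by blast
    have ab: "(a mod p, b mod p) = u p" if "p \<in> F" for p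
    proof -
      have "u p \<in> {..<p} \<times> {..<p}"
        using u T that by (blast dest: PiE_mem)
      then show ?thesis
        using a b that by (cases "u p") auto
    qed
    have "res (a, b) = restrict u F"
      using ab by (simp add: res_def cong: restrict_cong)
    also have "\<dots> = u"
      using u by (rule PiE_restrict)
    finally have "res (a, b) = u" .
    moreover have "(a, b) \<in> ?A"
      using a(1) b(1) ab u by (auto dest: PiE_mem)
    ultimately show "u \<in> res ` ?A" by blast
  qed
  moreover have "finite ?A"
    by (rule finite_subset[of _ "{..<\<Prod>F} \<times> {..<\<Prod>F}"]) auto
  ultimately have "card (PiE F T) \<le> card ?A"
    by (meson card_image_le card_mono finite_imageI le_trans)
  then show ?thesis
    using F by (simp add: card_PiE)
qed

definition spoiled :: "nat \<Rightarrow> nat \<Rightarrow> (nat \<times> nat) set" where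
  "spoiled k p = {(a, b). p dvd b \<and> p dvd a * (a + k)}"

text \<open>For prime \<open>p\<close> this is the density of \<^term>\<open>spoiled k p\<close>, as the two roots of \<open>x (x + k)\<close> modulo \<open>p\<close> collapse into
  one precisely if \<open>p\<close> divides \<open>k\<close>.\<close>

definition spoiled_density :: "nat \<Rightarrow> nat \<Rightarrow> real" where
  "spoiled_density k p = (if p dvd k then 1 else 2) / (real p)\<^sup>2"

lemma spoiled_mod: "(a mod p, b mod p) \<in> spoiled k p \<longleftrightarrow> (a, b) \<in> spoiled k p"
proof -
  have "(a mod p) * (a mod p + k) mod p = a * (a + k) mod p"
    by (intro mod_mult_cong) (simp_all add: mod_add_left_eq)
  then show ?thesis by (simp add: spoiled_def dvd_eq_mod_eq_0)
qed

lemma card_unspoiled_residues_ge: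
  assumes "prime p"
  shows "real (card ({..<p} \<times> {..<p} - spoiled k p)) \<ge> (real p)\<^sup>2 * (1 - spoiled_density k p)"
proof -
  \<comment> \<open>The nonzero root of \<open>x (x + k)\<close> modulo \<open>p\<close>, provided that \<open>p\<close> does not divide \<open>k\<close>.\<close>
  define r where "r = p - k mod p"
  have p: "p > 0" using assms by (simp add: prime_gt_0_nat)
  have root: "a = 0 \<or> (\<not> p dvd k \<and> a = r)" if "a < p" "p dvd a * (a + k)" for a
  proof -
    have "p dvd a \<or> p dvd a + k"
      using that(2) prime_dvd_mult_iff[OF assms, of a "a + k"] by simp
    then show ?thesis
    proof
      assume "p dvd a"
      with that(1) show ?thesis by (metis dvd_imp_le gr0I leD)
    next
      assume "p dvd a + k"
      then have "p dvd a + k mod p"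
        by (simp add: dvd_eq_mod_eq_0 mod_simps)
      then obtain c where c: "a + k mod p = p * c" ..
      moreover have "k mod p < p" using p by simp
      ultimately have "p * c < p * 2" using that(1) by linarith
      then have "c = 0 \<or> c = 1" by auto
      then show ?thesis
        using c that(1) by (auto simp: r_def dvd_eq_mod_eq_0)
    qed
  qed
  have "({..<p} \<times> {..<p}) \<inter> spoiled k p \<subseteq>
      (if p dvd k then {(0, 0)} else {(0, 0), (r, 0)})" (is "?S \<subseteq> ?R")
    using root by (auto simp: spoiled_def dest: dvd_imp_le)
  then have "card ?S \<le> card ?R"
    by (intro card_mono) auto
  also have "\<dots> \<le> (if p dvd k then 1 else 2)"
    by (auto simp: card_insert_if)
  finally have S: "card ?S \<le> (if p dvd k then 1 else 2)" .
  have "card ({..<p} \<times> {..<p} - spoiled k p) = p * p - card ?S"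
    by (subst card_Diff_subset_Int) (auto simp: card_cartesian_product)
  then have "real (card ({..<p} \<times> {..<p} - spoiled k p)) \<ge> real p * real p - real (card ?S)"
    by (simp flip: of_nat_mult)
  moreover have "real (card ?S) \<le> (real p)\<^sup>2 * spoiled_density k p"
    using S p by (auto simp: spoiled_density_def split: if_splits)
  ultimately show ?thesis
    by (simp add: algebra_simps power2_eq_square)
qed

text \<open>Each full period contributes one copy of the residue count. In each coordinate two periods
  are given up: the incomplete last one, and the first one, which contains the coordinate \<open>0\<close> that
  \<^const>\<open>grid_square\<close> excludes.\<close>

lemma card_sieved_square_ge:
  fixes F :: "nat set"
  assumes F: "finite F" "\<And>p. p \<in> F \<Longrightarrow> prime p"
    and N: "N \<ge> 2 * \<Prod>F"
  shows "real (card (grid_square N - (\<Union>p\<in>F. spoiled k p))) \<ge>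
    (real N - 2 * real (\<Prod>F))\<^sup>2 * (\<Prod>p\<in>F. 1 - spoiled_density k p)"
proof -
  define M where "M = \<Prod>F"
  have M: "M > 0" using F by (auto simp: M_def prime_gt_0_nat intro!: prod_pos)
  have dvdM: "p dvd M" if "p \<in> F" for p
    using that F by (auto simp: M_def dvd_prodI[where f="\<lambda>x. x"])
  \<comment> \<open>The number of periods that are kept in each coordinate.\<close>
  define Q where "Q = N div M - 1"
  define A where "A = {(a, b) \<in> {..<M} \<times> {..<M}.
    \<forall>p\<in>F. (a mod p, b mod p) \<in> {..<p} \<times> {..<p} - spoiled k p}"
  define h where "h = (\<lambda>((i, j), (a, b)). ((i + 1) * M + a, (j + 1) * M + b))"
  have dens_le: "spoiled_density k p \<le> 1" if "p \<in> F" for p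
  proof -
    have "(2::real)\<^sup>2 \<le> (real p)\<^sup>2"
      using F(2)[OF that] prime_ge_2_nat[of p] by (intro power_mono) auto
    then show ?thesis by (auto simp: spoiled_density_def divide_le_eq_1)
  qed
  have "real M ^ 2 * (\<Prod>p\<in>F. 1 - spoiled_density k p) =
      (\<Prod>p\<in>F. (real p)\<^sup>2 * (1 - spoiled_density k p))"
    by (simp add: M_def prod.distrib prod_power_distrib)
  also have "\<dots> \<le> (\<Prod>p\<in>F. real (card ({..<p} \<times> {..<p} - spoiled k p)))"
    using F(2) dens_le by (intro prod_mono) (auto simp: card_unspoiled_residues_ge)
  also have "\<dots> = real (\<Prod>p\<in>F. card ({..<p} \<times> {..<p} - spoiled k p))"
    by simp
  also have "\<dots> \<le> real (card A)"
    unfolding A_def M_def of_nat_le_iff using F by (intro card_residue_pairs_ge) auto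
  finally have cardA: "real M ^ 2 * (\<Prod>p\<in>F. 1 - spoiled_density k p) \<le> real (card A)" .
  have finA: "finite A"
    by (rule finite_subset[of _ "{..<M} \<times> {..<M}"]) (auto simp: A_def)
  have inj: "inj_on h (({..<Q} \<times> {..<Q}) \<times> A)"
  proof (rule inj_onI)
    fix x y
    assume xy: "x \<in> ({..<Q} \<times> {..<Q}) \<times> A" "y \<in> ({..<Q} \<times> {..<Q}) \<times> A" "h x = h y"
    obtain i j a b where x: "x = ((i, j), (a, b))" by (metis surj_pair)
    obtain i' j' a' b' where y: "y = ((i', j'), (a', b'))" by (metis surj_pair)
    from xy have lt: "a < M" "b < M" "a' < M" "b' < M"
      and eq: "(i + 1) * M + a = (i' + 1) * M + a'" "(j + 1) * M + b = (j' + 1) * M + b'"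
      by (auto simp: x y A_def h_def)
    have digits: "x = x' \<and> c = c'" if "c < M" "c' < M" "(x + 1) * M + c = (x' + 1) * M + c'"
      for x x' c c'
    proof -
      have "c = c'" using that by (metis mod_less mod_mult_self3)
      then show ?thesis using that(3) M by simp
    qed
    show "x = y"
      using digits[OF lt(1,3) eq(1)] digits[OF lt(2,4) eq(2)] by (simp add: x y)
  qed
  have bound: "(i + 1) * M + c \<in> {1..N}" if "i < Q" "c < M" for i c
  proof -
    have "i + 2 \<le> N div M" using that by (simp add: Q_def)
    then have "(i + 2) * M \<le> N div M * M" by (rule mult_le_mono1)
    also have "\<dots> \<le> N" by simp
    finally show ?thesis using that M by (simp add: algebra_simps)
  qed
  have unspoiled: "((i + 1) * M + a, (j + 1) * M + b) \<notin> spoiled k p"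
    if "(a, b) \<in> A" "p \<in> F" for i j a b p
  proof -
    have "((x + 1) * M + c) mod p = c mod p" for x c
    proof -
      have "p dvd (x + 1) * M" using dvdM[OF that(2)] by (rule dvd_mult)
      then show ?thesis by (metis add_0 dvd_imp_mod_0 mod_add_left_eq)
    qed
    then have "((i + 1) * M + a) mod p = a mod p" "((j + 1) * M + b) mod p = b mod p"
      by blast+
    then show ?thesis
      using that spoiled_mod[of "(i + 1) * M + a" p "(j + 1) * M + b" k]
      by (auto simp: A_def)
  qed
  have sub: "h ` (({..<Q} \<times> {..<Q}) \<times> A) \<subseteq> grid_square N - (\<Union>p\<in>F. spoiled k p)"
  proof
    fix y assume "y \<in> h ` (({..<Q} \<times> {..<Q}) \<times> A)"
    then obtain i j a b where *: "i < Q" "j < Q" "(a, b) \<in> A"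
      and y: "y = ((i + 1) * M + a, (j + 1) * M + b)"
      by (auto simp: h_def)
    then have "a < M" "b < M" by (auto simp: A_def)
    with * unspoiled[OF *(3)] bound show "y \<in> grid_square N - (\<Union>p\<in>F. spoiled k p)"
      unfolding y grid_square_def by blast
  qed
  have "Q * Q * card A = card (h ` (({..<Q} \<times> {..<Q}) \<times> A))"
    using inj by (simp add: card_image card_cartesian_product)
  also have "\<dots> \<le> card (grid_square N - (\<Union>p\<in>F. spoiled k p))"
    using sub by (intro card_mono) (auto simp: grid_square_def)
  finally have card_ge: "real Q ^ 2 * real (card A) \<le>
      real (card (grid_square N - (\<Union>p\<in>F. spoiled k p)))"
    by (simp add: power2_eq_square flip: of_nat_mult)
  have "N < N div M * M + M"
    using M by (metis div_mult_mod_eq mod_less_divisor nat_add_left_cancel_less)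
  moreover have "N div M \<ge> 1"
    using N M by (simp add: M_def[symmetric] Suc_le_eq div_greater_zero_iff)
  then have "N div M = Q + 1" by (simp add: Q_def)
  ultimately have "N \<le> Q * M + 2 * M" by (simp add: algebra_simps)
  then have "real N \<le> real (Q * M + 2 * M)" by (simp only: of_nat_le_iff)
  then have "(real N - 2 * real M)\<^sup>2 \<le> (real Q * real M)\<^sup>2"
    using N by (intro power_mono) (auto simp: M_def[symmetric] simp flip: of_nat_mult)
  then have "(real N - 2 * real M)\<^sup>2 * (\<Prod>p\<in>F. 1 - spoiled_density k p) \<le>
      (real Q * real M)\<^sup>2 * (\<Prod>p\<in>F. 1 - spoiled_density k p)"
    using dens_le by (intro mult_right_mono prod_nonneg) auto
  also have "\<dots> \<le> real Q ^ 2 * real (card A)"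
    using mult_left_mono[OF cardA, of "real Q ^ 2"] by (simp add: power_mult_distrib mult.assoc)
  finally show ?thesis using card_ge by (simp add: M_def)
qed

section \<open>The contribution of the large primes\<close>

lemma card_shifted_multiples_le:
  fixes p :: nat
  assumes "p > 0"
  shows "real (card {a \<in> {1..N}. p dvd a + k}) \<le> real (N + k) / real p"
proof -
  have "card {a \<in> {1..N}. p dvd a + k} \<le> card {1..(N + k) div p}"
  proof (rule card_inj_on_le[where f = "\<lambda>a. (a + k) div p"])
    show "inj_on (\<lambda>a. (a + k) div p) {a \<in> {1..N}. p dvd a + k}"
      by (auto simp: inj_on_def dest: dvd_div_eq_cancel)
    show "(\<lambda>a. (a + k) div p) ` {a \<in> {1..N}. p dvd a + k} \<subseteq> {1..(N + k) div p}"
      using assms by (auto simp: div_le_mono Suc_le_eq div_greater_zero_iff dest: dvd_imp_le)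
  qed simp
  then have "real (card {a \<in> {1..N}. p dvd a + k}) \<le> real ((N + k) div p)"
    by simp
  also have "\<dots> \<le> real (N + k) / real p"
    by (rule of_nat_div_le_of_nat)
  finally show ?thesis .
qed

text \<open>Here \<open>b\<close> has at most \<open>N / p\<close> values, and \<open>a\<close> at most \<open>N / p + (N + k) / p\<close>. The constant
  \<open>k + 2\<close> is crude, but it is uniform in \<open>N\<close> and \<open>p\<close>.\<close>

lemma card_spoiled_square_le:
  assumes "prime p" "N > 0"
  shows "real (card (grid_square N \<inter> spoiled k p)) \<le> (real k + 2) * (real N)\<^sup>2 / (real p)\<^sup>2"
proof -
  have p: "p > 0" using assms by (simp add: prime_gt_0_nat)
  let ?D = "\<lambda>j. {a \<in> {1..N}. p dvd a + j}"
  have "grid_square N \<inter> spoiled k p \<subseteq> (?D 0 \<union> ?D k) \<times> ?D 0"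
    using assms(1) by (auto simp: grid_square_def spoiled_def prime_dvd_mult_iff)
  then have "card (grid_square N \<inter> spoiled k p) \<le> card ((?D 0 \<union> ?D k) \<times> ?D 0)"
    by (intro card_mono) auto
  also have "\<dots> \<le> (card (?D 0) + card (?D k)) * card (?D 0)"
    by (simp add: card_cartesian_product card_Un_le)
  finally have "real (card (grid_square N \<inter> spoiled k p)) \<le>
      (real (card (?D 0)) + real (card (?D k))) * real (card (?D 0))"
    by (simp flip: of_nat_mult of_nat_add)
  also have "\<dots> \<le> (real N / real p + real (N + k) / real p) * (real N / real p)"
    using card_shifted_multiples_le[OF p, of N 0] card_shifted_multiples_le[OF p, of N k]
    by (intro mult_mono add_mono) auto
  also have "\<dots> = (2 * real N + real k) * real N / (real p)\<^sup>2"
    by (simp add: power2_eq_square add_divide_distrib algebra_simps)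
  also have "\<dots> \<le> ((real k + 2) * real N) * real N / (real p)\<^sup>2"
  proof -
    have "real k * 1 \<le> real k * real N"
      using assms(2) by (intro mult_left_mono) auto
    then show ?thesis
      by (intro divide_right_mono mult_right_mono) (auto simp: algebra_simps)
  qed
  finally show ?thesis by (simp add: power2_eq_square mult.assoc)
qed

text \<open>The sum is dominated by the telescoping sum of \<open>1 / (n - 1) - 1 / n\<close>.\<close>

lemma sum_inverse_squares_tail_le:
  assumes "z > 0"
  shows "(\<Sum>n\<in>{z<..N}. 1 / (real n)\<^sup>2) \<le> 1 / real z"
proof (cases "z \<le> N")
  case True
  then have "(\<Sum>n\<in>{z<..N}. 1 / (real n)\<^sup>2) \<le> 1 / real z - 1 / real N"
  proof (induction N rule: dec_induct)
    case (step n)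
    have n: "real n > 0" using step.hyps assms by simp
    have "{z<..Suc n} = insert (Suc n) {z<..n}" using step.hyps by auto
    then have "(\<Sum>n\<in>{z<..Suc n}. 1 / (real n)\<^sup>2) =
        1 / (real (Suc n))\<^sup>2 + (\<Sum>n\<in>{z<..n}. 1 / (real n)\<^sup>2)"
      by simp
    moreover have "1 / (real (Suc n))\<^sup>2 \<le> 1 / (real n * real (Suc n))"
      using n by (intro divide_left_mono) (auto simp: power2_eq_square)
    moreover have "1 / (real n * real (Suc n)) = 1 / real n - 1 / real (Suc n)"
      using n by (simp add: field_simps)
    ultimately show ?case using step.IH by linarith
  qed simp
  then show ?thesis by (smt (verit) divide_nonneg_nonneg of_nat_0_le_iff)
qed simp

lemma card_large_prime_points_le:
  assumes "z > 0" "N > 0"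
  shows "real (card (grid_square N \<inter> (\<Union>p\<in>{p\<in>{z<..N}. prime p}. spoiled k p))) \<le>
    (real k + 2) * (real N)\<^sup>2 / real z"
proof -
  let ?P = "{p\<in>{z<..N}. prime p}"
  have "real (card (grid_square N \<inter> (\<Union>p\<in>?P. spoiled k p))) \<le>
      real (\<Sum>p\<in>?P. card (grid_square N \<inter> spoiled k p))"
    unfolding Int_UN_distrib of_nat_le_iff by (rule card_UN_le) simp
  also have "\<dots> \<le> (\<Sum>p\<in>?P. (real k + 2) * (real N)\<^sup>2 / (real p)\<^sup>2)"
    unfolding of_nat_sum using assms by (intro sum_mono card_spoiled_square_le) auto
  also have "\<dots> \<le> (\<Sum>p\<in>{z<..N}. (real k + 2) * (real N)\<^sup>2 / (real p)\<^sup>2)"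
    by (intro sum_mono2) auto
  also have "\<dots> = (real k + 2) * (real N)\<^sup>2 * (\<Sum>p\<in>{z<..N}. 1 / (real p)\<^sup>2)"
    by (simp add: sum_distrib_left)
  also have "\<dots> \<le> (real k + 2) * (real N)\<^sup>2 * (1 / real z)"
    using assms by (intro mult_left_mono sum_inverse_squares_tail_le) auto
  finally show ?thesis by simp
qed

section \<open>The density bound\<close>

text \<open>The primes up to \<open>N\<close> decide coprimality inside the square, because a common prime divisor
  of \<open>b\<close> and \<open>a (a + k)\<close> is at most \<open>b\<close>.\<close>

lemma unspoiled_subset_V:
  "grid_square N - (\<Union>p\<in>{p. prime p \<and> p \<le> N}. spoiled k p) \<subseteq> V k \<inter> grid_square N"
proof
  fix P assume P: "P \<in> grid_square N - (\<Union>p\<in>{p. prime p \<and> p \<le> N}. spoiled k p)"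
  obtain a b where ab: "P = (a, b)" by (cases P)
  from P have pos: "a > 0" "b > 0" and "b \<le> N"
    and un: "\<And>p. prime p \<Longrightarrow> p \<le> N \<Longrightarrow> \<not> (p dvd b \<and> p dvd a * (a + k))"
    by (auto simp: ab grid_square_def spoiled_def)
  have "coprime b (a * (a + k))"
  proof (rule ccontr)
    assume "\<not> coprime b (a * (a + k))"
    then obtain p where "prime p" "p dvd gcd b (a * (a + k))"
      using prime_factor_nat coprime_iff_gcd_eq_1 by blast
    then have "prime p" "p dvd b" "p dvd a * (a + k)"
      by simp_all
    moreover from \<open>p dvd b\<close> have "p \<le> N"
      using pos \<open>b \<le> N\<close> by (auto dest: dvd_imp_le)
    ultimately show False using un by blast
  qed
  with pos P show "P \<in> V k \<inter> grid_square N"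
    by (auto simp: ab coprime_imp_visible)
qed

lemma dens_V_ge_truncated:
  assumes "dens_exists (V k)" "z > 0"
  shows "dens (V k) \<ge> (\<Prod>p | prime p \<and> p \<le> z. 1 - spoiled_density k p) - (real k + 2) / real z"
proof -
  define F where "F = {p. prime p \<and> p \<le> z}"
  define c where "c = (\<Prod>p\<in>F. 1 - spoiled_density k p)"
  define M where "M = \<Prod>F"
  have F: "finite F" "\<And>p. p \<in> F \<Longrightarrow> prime p"
    by (auto simp: F_def)
  have ge: "dens_ratio (V k) N \<ge> (1 - 2 * real M / real N)\<^sup>2 * c - (real k + 2) / real z"
    if N: "N \<ge> 2 * M + 1" for N
  proof -
    let ?L = "\<Union>p\<in>{p\<in>{z<..N}. prime p}. spoiled k p"
    let ?G = "grid_square N - (\<Union>p\<in>F. spoiled k p)"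
    have N0: "N > 0" using N by simp
    have "{p. prime p \<and> p \<le> N} \<subseteq> F \<union> {p\<in>{z<..N}. prime p}"
      by (auto simp: F_def)
    then have "?G - grid_square N \<inter> ?L \<subseteq>
        grid_square N - (\<Union>p\<in>{p. prime p \<and> p \<le> N}. spoiled k p)"
      by blast
    also have "\<dots> \<subseteq> V k \<inter> grid_square N" by (rule unspoiled_subset_V)
    finally have "card (?G - grid_square N \<inter> ?L) \<le> card (V k \<inter> grid_square N)"
      by (intro card_mono) (auto simp: grid_square_def)
    moreover have "card ?G - card (grid_square N \<inter> ?L) \<le> card (?G - grid_square N \<inter> ?L)"
      by (rule diff_card_le_card_Diff) (auto simp: grid_square_def)
    ultimately have "real (card ?G) - real (card (grid_square N \<inter> ?L)) \<le>
        real (card (V k \<inter> grid_square N))"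
      by linarith
    moreover have "real (card ?G) \<ge> (real N - 2 * real M)\<^sup>2 * c"
      unfolding M_def c_def using N F by (intro card_sieved_square_ge) (auto simp: M_def)
    moreover have "real (card (grid_square N \<inter> ?L)) \<le> (real k + 2) * (real N)\<^sup>2 / real z"
      using assms(2) N0 by (rule card_large_prime_points_le)
    ultimately have "(real N - 2 * real M)\<^sup>2 * c - (real k + 2) * (real N)\<^sup>2 / real z \<le>
        real (card (V k \<inter> grid_square N))"
      by linarith
    then have "((real N - 2 * real M)\<^sup>2 * c - (real k + 2) * (real N)\<^sup>2 / real z) / (real N)\<^sup>2 \<le>
        dens_ratio (V k) N"
      unfolding dens_ratio_def by (rule divide_right_mono) simp
    moreover have "((real N - 2 * real M)\<^sup>2 * c - (real k + 2) * (real N)\<^sup>2 / real z) / (real N)\<^sup>2 =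
        ((real N - 2 * real M) / real N)\<^sup>2 * c - (real k + 2) / real z"
      using N0 by (subst diff_divide_distrib) (simp add: power_divide)
    moreover have "(real N - 2 * real M) / real N = 1 - 2 * real M / real N"
      using N0 by (simp add: diff_divide_distrib)
    ultimately show ?thesis by simp
  qed
  have "(\<lambda>N. (1 - 2 * real M / real N)\<^sup>2 * c - (real k + 2) / real z)
      \<longlonglongrightarrow> (1 - 0)\<^sup>2 * c - (real k + 2) / real z"
    by (intro tendsto_intros lim_const_over_n)
  moreover have "dens_ratio (V k) \<longlonglongrightarrow> dens (V k)"
    using assms(1) by (simp add: dens_exists_def dens_def convergent_LIMSEQ_iff)
  ultimately have "(1 - 0)\<^sup>2 * c - (real k + 2) / real z \<le> dens (V k)"
    by (rule LIMSEQ_le) (use ge in blast)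
  then show ?thesis by (simp add: c_def F_def)
qed

text \<open>Once \<open>z\<close> reaches \<open>k\<close>, all prime divisors of \<open>k\<close> occur among the primes up to \<open>z\<close>, so that
  the correction for them no longer depends on \<open>z\<close>.\<close>

lemma prod_unspoiled_density:
  assumes "k > 0" "z \<ge> k"
  shows "(\<Prod>p | prime p \<and> p \<le> z. 1 - spoiled_density k p) =
    (\<Prod>p | prime p \<and> p \<le> z. 1 - 2 / (real p)\<^sup>2) *
    (\<Prod>p | prime p \<and> p dvd k. 1 + 1 / ((real p)\<^sup>2 - 2))"
proof -
  let ?P = "{p. prime p \<and> p \<le> z}"
  let ?g = "\<lambda>p. if p dvd k then 1 + 1 / ((real p)\<^sup>2 - 2) else 1"
  have "1 - spoiled_density k p = (1 - 2 / (real p)\<^sup>2) * ?g p" if "prime p" for p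
  proof -
    have "(2::real)\<^sup>2 \<le> (real p)\<^sup>2"
      using prime_ge_2_nat[OF that] by (intro power_mono) auto
    then have "(real p)\<^sup>2 - 2 > 0" "(real p)\<^sup>2 > 0" using prime_gt_0_nat[OF that] by auto
    then show ?thesis
      by (simp add: spoiled_density_def divide_simps)
  qed
  then have "(\<Prod>p\<in>?P. 1 - spoiled_density k p) = (\<Prod>p\<in>?P. 1 - 2 / (real p)\<^sup>2) * (\<Prod>p\<in>?P. ?g p)"
    by (simp flip: prod.distrib)
  also have "(\<Prod>p\<in>?P. ?g p) = (\<Prod>p\<in>?P \<inter> {p. p dvd k}. 1 + 1 / ((real p)\<^sup>2 - 2))"
    by (subst prod.inter_restrict) (auto intro: prod.cong)
  also have "?P \<inter> {p. p dvd k} = {p. prime p \<and> p dvd k}"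
    using assms by (auto dest: dvd_imp_le)
  finally show ?thesis .
qed

theorem corollary1p5:
  fixes k :: nat
  assumes "k \<ge> 2"
    and "dens_exists (V k)"
  shows "dens (V k) \<ge>
    prod_over_primes (\<lambda>p. 1 - 2 / (real p)\<^sup>2) *
    (\<Prod>p | prime p \<and> p dvd k. 1 + 1 / ((real p)\<^sup>2 - 2))"
proof -
  let ?f = "\<lambda>n::nat. if prime n then 1 - 2 / (real n)\<^sup>2 else (1::real)"
  let ?B = "\<Prod>p | prime p \<and> p dvd k. 1 + 1 / ((real p)\<^sup>2 - 2)"
  have "(\<lambda>z. (\<Prod>n\<le>z. ?f n)) \<longlonglongrightarrow> prod_over_primes (\<lambda>p. 1 - 2 / (real p)\<^sup>2)"
    unfolding prod_over_primes_def
    by (rule convergent_prod_LIMSEQ[OF convergent_prod_one_minus_two_over_prime_squared])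
  then have "(\<lambda>z. (\<Prod>n\<le>z. ?f n) * ?B - (real k + 2) / real z)
      \<longlonglongrightarrow> prod_over_primes (\<lambda>p. 1 - 2 / (real p)\<^sup>2) * ?B - 0"
    by (intro tendsto_intros lim_const_over_n)
  moreover have "(\<Prod>n\<le>z. ?f n) * ?B - (real k + 2) / real z \<le> dens (V k)" if "z \<ge> k" for z
  proof -
    have "{p. prime p \<and> p \<le> z} = {..z} \<inter> {p. prime p}" by auto
    then have "(\<Prod>n\<le>z. ?f n) = (\<Prod>p | prime p \<and> p \<le> z. 1 - 2 / (real p)\<^sup>2)"
      by (simp add: prod.inter_restrict)
    then show ?thesis
      using dens_V_ge_truncated[OF assms(2), of z] prod_unspoiled_density[of k z] that assms(1)
      by simp
  qed
  ultimately have "prod_over_primes (\<lambda>p. 1 - 2 / (real p)\<^sup>2) * ?B - 0 \<le> dens (V k)"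
    by (intro LIMSEQ_le_const2) blast+
  then show ?thesis by simp
qed

end
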